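(* Let $\mathcal{L}$ be a finite atomic meet-semilattice with minimal element $\hat 0$, and let $\mathcal{G}$ be a building set in $\mathcal{L}$. Then the nested set complex $\mathcal{N}(\mathcal{L},\mathcal{G})$ is homeomorphic to the order complex of $\mathcal{L}_{>\hat 0}=\mathcal{L}\setminus\{\hat 0\}$: \[ \mathcal{N}(\mathcal{L},\mathcal{G})\;\cong\;\Delta(\mathcal{L}_{>\hat 0}). \]
   Context: All posets are finite. A meet-semilattice is a poset in which greatest lower bounds exist for any subset of elements; a finite meet-semilattice $\mathcal{L}$ has a minimal element, denoted $\hat 0$, and $\mathcal{L}_{>\hat 0}:=\mathcal{L}\setminus\{\hat 0\}$. Atoms are the minimal elements of $\mathcal{L}_{>\hat 0}$; $\mathcal{L}$ is atomic if every element is the join of the atoms below it ($\hat 0$ being the empty join). For $X,Y\in\mathcal{L}$, $[X,Y]:=\{Z\in\mathcal{L}\mid X\le Z\le Y\}$. For $\mathcal{S}\subseteq\mathcal{L}$, $\max\mathcal{S}$ is the set of maximal elements of $\mathcal{S}$, and $\mathcal{S}_{\le X}:=\{Y\in\mathcal{S}\mid Y\le X\}$. Joins ($\vee$) are least upper bounds in $\mathcal{L}$, when they exist. Building set: a subset $\mathcal{G}\subseteq\mathcal{L}_{>\hat 0}$ is a building set in $\mathcal{L}$ if for every $X\in\mathcal{L}_{>\hat 0}$, writing $\max\mathcal{G}_{\le X}=\{G_1,\dots,G_k\}$, there is an isomorphism of posets \[ \varphi_X:\ \prod_{j=1}^k[\hat 0,G_j]\ \xrightarrow{\ \cong\ }\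 [\hat 0,X] \] with $\varphi_X(\hat 0,\dots,G_j,\dots,\hat 0)=G_j$ for $j=1,\dots,k$ (where $G_j$ stands in the $j$-th coordinate). Nested sets: given a building set $\mathcal{G}$ in $\mathcal{L}$, a subset $\mathcal{S}\subseteq\mathcal{G}$ is called nested (or $\mathcal{G}$-nested) if for any set of pairwise incomparable elements $X_1,\dots,X_t$ in $\mathcal{S}$ with $t\ge 2$, the join $X_1\vee\dots\vee X_t$ exists in $\mathcal{L}$ and does not belong to $\mathcal{G}$. The $\mathcal{G}$-nested sets form an abstract simplicial complex $\mathcal{N}(\mathcal{L},\mathcal{G})$ on the vertex set $\mathcal{G}$, the nested set complex. Order complex: for a poset $P$, $\Delta(P)$ is the abstract simplicial complex on the elements of $P$ whose simplices are the linearly ordered subsets of $P$. Two abstract simplicial complexes are called homeomorphic if their geometric realizations are homeomorphic. *)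

theory Defs
  imports "HOL-Analysis.Analysis" "HOL-Library.Lub_Glb"
begin

section \<open>Atomic posets, building sets and nested sets\<close>

text \<open>
  The poset is the whole of a type whose order is given by type classes, with \<^term>\<open>bot\<close> as
  its minimal element. A join \<open>X\<close> of \<open>S\<close> is expressed by \<^term>\<open>isLub UNIV S X\<close>, as joins need
  not exist.
\<close>

definition maximal_elements :: "'a::order set \<Rightarrow> 'a set" where
  "maximal_elements S = {X \<in> S. \<forall>Y\<in>S. X \<le> Y \<longrightarrow> Y = X}"

definition atoms :: "'a::order_bot set" where
  "atoms = {A. A \<noteq> bot \<and> (\<forall>Y. Y \<noteq> bot \<and> Y \<le> A \<longrightarrow> Y = A)}"

definition atomic :: "'a::order_bot itself \<Rightarrow> bool" where
  "atomic _ \<longleftrightarrow> (\<forall>X::'a. isLub UNIV {A \<in> atoms. A \<le> X} X)"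

text \<open>
  The factors of the product are indexed by the elements of \<open>max G\<^bsub>\<le>X\<^esub>\<close> themselves, instead of
  by an enumeration \<open>G\<^sub>1, \<dots>, G\<^sub>k\<close>; elements of the product are extensional functions, compared
  coordinatewise on the index set.
\<close>

definition building_set :: "'a::order_bot set \<Rightarrow> bool" where
  "building_set \<G> \<longleftrightarrow> bot \<notin> \<G> \<and>
    (\<forall>X. X \<noteq> bot \<longrightarrow>
      (let M = maximal_elements {G \<in> \<G>. G \<le> X} in
       \<exists>\<phi>. bij_betw \<phi> (\<Pi>\<^sub>E G\<in>M. {bot..G}) {bot..X} \<and>
           (\<forall>f \<in> (\<Pi>\<^sub>E G\<in>M. {bot..G}). \<forall>g \<in> (\<Pi>\<^sub>E G\<in>M. {bot..G}).
              \<phi> f \<le> \<phi> g \<longleftrightarrow> (\<forall>G\<in>M. f G \<le> g G)) \<and>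
           (\<forall>G\<in>M. \<phi> (\<lambda>H\<in>M. if H = G then G else bot) = G)))"

definition nested :: "'a::order set \<Rightarrow> 'a set \<Rightarrow> bool" where
  "nested \<G> S \<longleftrightarrow> S \<subseteq> \<G> \<and>
    (\<forall>T. T \<subseteq> S \<and> finite T \<and> card T \<ge> 2 \<and>
         (\<forall>X\<in>T. \<forall>Y\<in>T. X \<noteq> Y \<longrightarrow> \<not> X \<le> Y) \<longrightarrow>
         (\<exists>J. isLub UNIV T J \<and> J \<notin> \<G>))"

section \<open>Abstract simplicial complexes\<close>

definition abstract_simplicial_complex :: "'v set \<Rightarrow> 'v set set \<Rightarrow> bool" where
  "abstract_simplicial_complex V K \<longleftrightarrow>
     (\<forall>\<sigma>\<in>K. finite \<sigma> \<and> \<sigma> \<subseteq> V) \<and> (\<forall>\<sigma>\<in>K. \<forall>\<tau>. \<tau> \<subseteq> \<sigma> \<longrightarrow> \<tau> \<in> K) \<and>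
     {} \<in> K \<and> (\<forall>v\<in>V. {v} \<in> K)"

definition nested_set_complex :: "'a::order set \<Rightarrow> 'a set set" where
  "nested_set_complex \<G> = {S. nested \<G> S}"

definition order_complex :: "'a::order set \<Rightarrow> 'a set set" where
  "order_complex P = {C. C \<subseteq> P \<and> Complete_Partial_Order.chain (\<le>) C}"

lemma abstract_simplicial_complex_nested_set_complex:
  fixes \<G> :: "'a::{finite, order} set"
  shows "abstract_simplicial_complex \<G> (nested_set_complex \<G>)"
proof -
  have "\<not> 2 \<le> card T" if "T \<subseteq> {v}" for T and v :: 'a
    using card_mono[OF _ that] by simp
  then show ?thesis
    unfolding abstract_simplicial_complex_def nested_set_complex_def nested_def
    by (auto; blast)
qed

lemma abstract_simplicial_complex_order_complex:
  fixes P :: "'a::{finite, order} set"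
  shows "abstract_simplicial_complex P (order_complex P)"
  unfolding abstract_simplicial_complex_def order_complex_def Complete_Partial_Order.chain_def
  by auto

text \<open>
  Points of the realization are given by barycentric coordinates: finitely supported convex
  weights on the vertices whose support is a simplex. The topology is that of pointwise
  convergence, which for a finite complex is the subspace topology from Euclidean space (for
  infinite complexes it would in general be coarser than the weak topology). The empty simplex
  contributes no point.
\<close>

definition geometric_realization :: "'v set set \<Rightarrow> ('v \<Rightarrow> real) topology" where
  "geometric_realization K =
     subtopology (powertop_real UNIV)
       {x. (\<forall>v. 0 \<le> x v) \<and> {v. x v \<noteq> 0} \<in> K \<and> (\<Sum>v | x v \<noteq> 0. x v) = 1}"

definition homeomorphic_complexes :: "'v set set \<Rightarrow> 'w set set \<Rightarrow> bool" where
  "homeomorphic_complexes K L \<longleftrightarrow>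
     geometric_realization K homeomorphic_space geometric_realization L"

end

theory Submission
  imports Defs
begin

text \<open>
  Write \<open>F X\<close> for the factors \<open>max G\<^bsub>\<le>X\<^esub>\<close> of \<open>X\<close>. Distributing the weight of each vertex \<open>X\<close> of the
  order complex evenly over the vertices \<open>F X\<close> gives a continuous map onto the realization of the
  nested set complex: the factors of the members of a chain form a nested set, and conversely the
  maximal elements of a nonempty nested set \<open>S\<close> are exactly the factors of their join \<open>J\<close>. A
  preimage of a point supported on \<open>S\<close> is therefore found by peeling off the smallest weight on
  \<open>max S = F J\<close> as weight on \<open>J\<close> and recursing, and this recovers the chain uniquely from the top
  down. A continuous bijection between compact Hausdorff spaces is a homeomorphism.
\<close>

section \<open>Factors of an element and the product decomposition they carry\<close>

definition factors :: "'a::order set \<Rightarrow> 'a \<Rightarrow> 'a set" where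
  "factors \<G> X = maximal_elements {G \<in> \<G>. G \<le> X}"

lemma maximal_elementsE:
  fixes S :: "'a::{finite, order} set"
  assumes "X \<in> S"
  obtains Y where "Y \<in> maximal_elements S" "X \<le> Y"
  using finite_has_maximal2[OF finite assms] unfolding maximal_elements_def by blast

lemma factors_subset: "factors \<G> X \<subseteq> \<G>"
  by (auto simp: factors_def maximal_elements_def)

lemma factors_le: "G \<in> factors \<G> X \<Longrightarrow> G \<le> X"
  by (auto simp: factors_def maximal_elements_def)

lemma factors_maximal: "G \<in> factors \<G> X \<Longrightarrow> H \<in> \<G> \<Longrightarrow> H \<le> X \<Longrightarrow> G \<le> H \<Longrightarrow> H = G"
  by (auto simp: factors_def maximal_elements_def)

lemma le_factorE:
  fixes X :: "'a::{finite, order}"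
  assumes "H \<in> \<G>" "H \<le> X"
  obtains G where "G \<in> factors \<G> X" "H \<le> G"
  using maximal_elementsE[of H "{G \<in> \<G>. G \<le> X}"] assms unfolding factors_def by blast

lemma factors_member: "G \<in> \<G> \<Longrightarrow> factors \<G> G = {G}"
  by (auto simp: factors_def maximal_elements_def)

lemma building_set_bot: "building_set \<G> \<Longrightarrow> bot \<notin> \<G>"
  by (simp add: building_set_def)

lemma factors_bot: "building_set \<G> \<Longrightarrow> factors \<G> bot = {}"
  using building_set_bot by (auto simp: factors_def maximal_elements_def bot_unique)

lemma building_setE:
  assumes "building_set \<G>" "X \<noteq> bot"
  obtains \<phi> where "bij_betw \<phi> (\<Pi>\<^sub>E G\<in>factors \<G> X. {bot..G}) {bot..X}"
    "\<And>f g. f \<in> (\<Pi>\<^sub>E G\<in>factors \<G> X. {bot..G}) \<Longrightarrow> g \<in> (\<Pi>\<^sub>E G\<in>factors \<G> X. {bot..G}) \<Longrightarrow>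
       \<phi> f \<le> \<phi> g \<longleftrightarrow> (\<forall>G\<in>factors \<G> X. f G \<le> g G)"
    "\<And>G. G \<in> factors \<G> X \<Longrightarrow> \<phi> (\<lambda>H\<in>factors \<G> X. if H = G then G else bot) = G"
proof -
  have "\<exists>\<phi>. bij_betw \<phi> (\<Pi>\<^sub>E G\<in>factors \<G> X. {bot..G}) {bot..X} \<and>
     (\<forall>f\<in>(\<Pi>\<^sub>E G\<in>factors \<G> X. {bot..G}). \<forall>g\<in>(\<Pi>\<^sub>E G\<in>factors \<G> X. {bot..G}).
         \<phi> f \<le> \<phi> g \<longleftrightarrow> (\<forall>G\<in>factors \<G> X. f G \<le> g G)) \<and>
     (\<forall>G\<in>factors \<G> X. \<phi> (\<lambda>H\<in>factors \<G> X. if H = G then G else bot) = G)"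
    using assms unfolding building_set_def factors_def Let_def by blast
  then show ?thesis
  proof (elim exE conjE)
    fix \<phi>
    assume \<phi>: "bij_betw \<phi> (\<Pi>\<^sub>E G\<in>factors \<G> X. {bot..G}) {bot..X}"
      "\<forall>f\<in>(\<Pi>\<^sub>E G\<in>factors \<G> X. {bot..G}). \<forall>g\<in>(\<Pi>\<^sub>E G\<in>factors \<G> X. {bot..G}).
         \<phi> f \<le> \<phi> g \<longleftrightarrow> (\<forall>G\<in>factors \<G> X. f G \<le> g G)"
      "\<forall>G\<in>factors \<G> X. \<phi> (\<lambda>H\<in>factors \<G> X. if H = G then G else bot) = G"
    show ?thesis
      by (rule that[OF \<phi>(1) \<phi>(2)[THEN bspec, THEN bspec] \<phi>(3)[THEN bspec]])
  qed
qed

text \<open>For \<open>X \<noteq> bot\<close>, the meet \<open>inf X Z\<close> lies in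
  \<open>{bot..X}\<close> and so has coordinates \<open>f\<close>. Every factor \<open>G\<close>
  lies below this meet, so its unit tuple lies below \<open>f\<close> and coordinate
  \<open>G\<close> of \<open>f\<close> is already the top \<open>G\<close>. Hence \<open>f\<close>
  dominates the coordinates of \<open>X\<close>, and \<open>X \<le> inf X Z\<close>. Together with
  \<open>factors_le\<close> this makes \<open>X\<close> the join of its factors.\<close>

lemma le_if_factors_le:
  fixes X Z :: "'a::{semilattice_inf, order_bot}"
  assumes b: "building_set \<G>" and le: "\<And>G. G \<in> factors \<G> X \<Longrightarrow> G \<le> Z"
  shows "X \<le> Z"
proof (cases "X = bot")
  case False
  let ?P = "\<Pi>\<^sub>E G\<in>factors \<G> X. {bot..G}"
  obtain \<phi> where \<phi>: "bij_betw \<phi> ?P {bot..X}"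
    "\<And>f g. f \<in> ?P \<Longrightarrow> g \<in> ?P \<Longrightarrow> \<phi> f \<le> \<phi> g \<longleftrightarrow> (\<forall>G\<in>factors \<G> X. f G \<le> g G)"
    "\<And>G. G \<in> factors \<G> X \<Longrightarrow> \<phi> (\<lambda>H\<in>factors \<G> X. if H = G then G else bot) = G"
    using building_setE[OF b False] by metis
  have e: "(\<lambda>H\<in>factors \<G> X. if H = G then G else bot) \<in> ?P" for G
    by (auto simp: PiE_iff)
  have "inf X Z \<in> \<phi> ` ?P" "X \<in> \<phi> ` ?P"
    using bij_betw_imp_surj_on[OF \<phi>(1)] by auto
  then obtain f g where f: "f \<in> ?P" "\<phi> f = inf X Z" and g: "g \<in> ?P" "\<phi> g = X" by force
  have "g G \<le> f G" if G: "G \<in> factors \<G> X" for G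
  proof -
    have "G \<le> \<phi> f" using f(2) le[OF G] factors_le[OF G] by simp
    then have "\<phi> (\<lambda>H\<in>factors \<G> X. if H = G then G else bot) \<le> \<phi> f" using \<phi>(3)[OF G] by simp
    then have "G \<le> f G" using \<phi>(2)[OF e f(1)] G by force
    moreover have "g G \<le> G" using g(1) G by (auto simp: PiE_iff)
    ultimately show ?thesis by simp
  qed
  then have "\<phi> g \<le> \<phi> f" using \<phi>(2)[OF g(1) f(1)] by blast
  then show ?thesis using f g by simp
qed simp

lemma factors_nonempty:
  fixes X :: "'a::{semilattice_inf, order_bot}"
  assumes "building_set \<G>" "X \<noteq> bot"
  shows "factors \<G> X \<noteq> {}"
  using le_if_factors_le[OF assms(1), of X bot] assms(2) by (auto simp: bot_unique)

text \<open>
  \<open>W\<close> is the image under the isomorphism of the tuple with \<open>K\<close> in the coordinate \<open>G\<close> and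
  the top element in every other coordinate.
\<close>

lemma replace_factor:
  fixes X G K :: "'a::order_bot"
  assumes b: "building_set \<G>" and G: "G \<in> factors \<G> X" and K: "K \<le> G"
  obtains W where "K \<le> W" "\<And>H. H \<in> factors \<G> X \<Longrightarrow> H \<noteq> G \<Longrightarrow> H \<le> W" "G \<le> W \<Longrightarrow> G \<le> K"
proof -
  have X: "X \<noteq> bot"
    using G factors_bot[OF b] by auto
  let ?P = "\<Pi>\<^sub>E G\<in>factors \<G> X. {bot..G}"
  obtain \<phi> where \<phi>: "bij_betw \<phi> ?P {bot..X}"
    "\<And>f g. f \<in> ?P \<Longrightarrow> g \<in> ?P \<Longrightarrow> \<phi> f \<le> \<phi> g \<longleftrightarrow> (\<forall>G\<in>factors \<G> X. f G \<le> g G)"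
    "\<And>G. G \<in> factors \<G> X \<Longrightarrow> \<phi> (\<lambda>H\<in>factors \<G> X. if H = G then G else bot) = G"
    using building_setE[OF b X] by metis
  let ?e = "\<lambda>G. (\<lambda>H\<in>factors \<G> X. if H = G then G else bot)"
  have e: "?e H \<in> ?P" for H
    by (auto simp: PiE_iff)
  \<comment> \<open>Comparison with the unit tuple \<open>?e H\<close> tests coordinate
    \<open>H\<close> alone, since its other coordinates are \<open>bot\<close>.\<close>
  have e_le: "H \<le> \<phi> f \<longleftrightarrow> H \<le> f H" if "H \<in> factors \<G> X" "f \<in> ?P" for H f
  proof -
    have "\<phi> (?e H) \<le> \<phi> f \<longleftrightarrow> (\<forall>H'\<in>factors \<G> X. ?e H H' \<le> f H')"
      by (rule \<phi>(2)[OF e that(2)])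
    also have "\<dots> \<longleftrightarrow> H \<le> f H"
      using that(1) by auto
    finally show ?thesis by (simp only: \<phi>(3)[OF that(1)])
  qed
  have "K \<in> \<phi> ` ?P"
    using bij_betw_imp_surj_on[OF \<phi>(1)] K factors_le[OF G] by auto
  then obtain k where k: "k \<in> ?P" "\<phi> k = K" by force
  define f where "f = (\<lambda>H\<in>factors \<G> X. if H = G then k G else H)"
  have f: "f \<in> ?P"
    using k(1) by (auto simp: f_def PiE_iff)
  show ?thesis
  proof
    show "K \<le> \<phi> f"
      using \<phi>(2)[OF k(1) f] k by (auto simp: f_def PiE_iff)
    show "H \<le> \<phi> f" if "H \<in> factors \<G> X" "H \<noteq> G" for H
      using e_le[OF that(1) f] that by (simp add: f_def)
    show "G \<le> K" if "G \<le> \<phi> f"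
      using e_le[OF G f] e_le[OF G k(1)] that k(2) G by (simp add: f_def)
  qed
qed

section \<open>Joins of nested sets and their factors\<close>

text \<open>The upper bounds form a finite nonempty set, and their meet is the join.\<close>

lemma isLub_bounded_exists:
  fixes T :: "'a::{finite, semilattice_inf} set"
  assumes "\<And>t. t \<in> T \<Longrightarrow> t \<le> B"
  shows "\<exists>J. isLub UNIV T J"
proof -
  let ?U = "{u. \<forall>t\<in>T. t \<le> u}"
  have "?U \<noteq> {}" using assms by auto
  then have "isLub UNIV T (Inf_fin ?U)"
    by (auto simp: isLub_def leastP_def isUb_def setle_def setge_def
        intro!: Inf_fin.boundedI Inf_fin.coboundedI)
  then show ?thesis ..
qed

lemma isLub_le: "isLub UNIV T J \<Longrightarrow> (\<And>t. t \<in> T \<Longrightarrow> t \<le> B) \<Longrightarrow> J \<le> (B :: 'a::order)"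
  by (auto simp: isLub_def leastP_def isUb_def setle_def setge_def)

lemma isLub_upper: "isLub UNIV T J \<Longrightarrow> t \<in> T \<Longrightarrow> t \<le> J"
  by (auto simp: isLub_def leastP_def isUb_def setle_def)

lemma nested_subset: "nested \<G> S \<Longrightarrow> S' \<subseteq> S \<Longrightarrow> nested \<G> S'"
  unfolding nested_def by (meson subset_trans)

lemma singleton_if_not_card_ge_2:
  fixes T :: "'a::finite set"
  assumes "T \<noteq> {}" "\<not> card T \<ge> 2"
  obtains t where "T = {t}"
proof -
  have "card T \<noteq> 0" using assms(1) by simp
  then have "card T = 1" using assms(2) by linarith
  then show ?thesis using that by (auto simp: card_1_singleton_iff)
qed

text \<open>Take \<open>J\<close> to be the join of the antichain \<open>T\<close> of maximal
  elements. For a factor \<open>G\<close> of \<open>J\<close>, let \<open>K\<close> be the join of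
  the members of \<open>T\<close> below \<open>G\<close>. Lowering coordinate \<open>G\<close> of
  \<open>J\<close> to \<open>K\<close> still leaves an upper bound of \<open>T\<close>, so
  minimality of \<open>J\<close> forces \<open>K = G\<close>. As \<open>G \<in> \<G>\<close>,
  nestedness allows only one member of \<open>T\<close> below \<open>G\<close>, and that member is
  \<open>G\<close>. Conversely, each member of \<open>T\<close> lies below a factor of
  \<open>J\<close>, which is itself in \<open>T\<close>, so the two agree.\<close>

lemma factors_nested_join:
  fixes S :: "'a::{finite, semilattice_inf, order_bot} set"
  assumes b: "building_set \<G>" and S: "nested \<G> S" "S \<noteq> {}"
  shows "\<exists>J. factors \<G> J = maximal_elements S"
proof -
  define T where "T = maximal_elements S"
  have TS: "T \<subseteq> S" and anti: "\<And>X Y. X \<in> T \<Longrightarrow> Y \<in> T \<Longrightarrow> X \<le> Y \<Longrightarrow> X = Y"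
    by (auto simp: T_def maximal_elements_def)
  have TG: "T \<subseteq> \<G>" using TS S(1) by (auto simp: nested_def)
  have join: "\<exists>J. isLub UNIV T' J \<and> J \<notin> \<G>" if "T' \<subseteq> T" "card T' \<ge> 2" for T'
  proof -
    have "\<forall>X\<in>T'. \<forall>Y\<in>T'. X \<noteq> Y \<longrightarrow> \<not> X \<le> Y" using that(1) anti by blast
    then show ?thesis using S(1) that TS unfolding nested_def by (meson finite subset_trans)
  qed
  have "T \<noteq> {}"
    using S(2) maximal_elementsE unfolding T_def by (metis empty_iff ex_in_conv)
  show ?thesis
  proof (cases "card T \<ge> 2")
    \<comment> \<open>Nestedness gives no information on singletons, but a lone maximal element is
      its own only factor and can serve as \<open>J\<close>.\<close>
    case False
    then obtain G where "T = {G}" using singleton_if_not_card_ge_2 \<open>T \<noteq> {}\<close> by blast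
    then show ?thesis using factors_member[of G \<G>] TG T_def by auto
  next
    case True
    then obtain J where J: "isLub UNIV T J" "J \<notin> \<G>" using join by blast
    have fT: "G \<in> T" if G: "G \<in> factors \<G> J" for G
    proof -
      let ?T = "{t \<in> T. t \<le> G}"
      obtain K where K: "isLub UNIV ?T K" using isLub_bounded_exists[of ?T G] by auto
      have "K \<le> G" using isLub_le[OF K] by auto
      obtain W where W: "K \<le> W" "\<And>H. H \<in> factors \<G> J \<Longrightarrow> H \<noteq> G \<Longrightarrow> H \<le> W"
        "G \<le> W \<Longrightarrow> G \<le> K"
        using replace_factor[OF b G \<open>K \<le> G\<close>] by blast
      \<comment> \<open>Members of \<open>T\<close> below \<open>G\<close> are absorbed by
        \<open>K\<close>; any other member lies below a different factor, and that coordinate was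
        left full.\<close>
      have "t \<le> W" if t: "t \<in> T" for t
      proof (cases "t \<le> G")
        case True
        then have "t \<le> K" using isLub_upper[OF K, of t] t by simp
        then show ?thesis using W(1) by (rule order_trans)
      next
        case False
        have "t \<in> \<G>" "t \<le> J" using isLub_upper[OF J(1) t] t TG by auto
        then obtain H where "H \<in> factors \<G> J" "t \<le> H" by (rule le_factorE)
        then show ?thesis using W(2)[of H] False order_trans[of t H W] by auto
      qed
      then have "J \<le> W" using isLub_le[OF J(1)] by blast
      then have "G \<le> W" using factors_le[OF G] order_trans by blast
      then have KG: "K = G" using W(3) \<open>K \<le> G\<close> by simp
      have GG: "G \<in> \<G>" using G factors_subset by blast
      \<comment> \<open>With two or more members, nestedness would put the join of \<open>?T\<close>
        outside \<open>\<G>\<close>, but that join is \<open>G\<close>.\<close>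
      have "\<not> card ?T \<ge> 2"
      proof
        assume "card ?T \<ge> 2"
        then obtain K' where K': "isLub UNIV ?T K'" "K' \<notin> \<G>" using join[of ?T] by auto
        have "K' = K"
          using isLub_le[OF K isLub_upper[OF K'(1)]] isLub_le[OF K'(1) isLub_upper[OF K]] by simp
        then show False using K'(2) KG GG by simp
      qed
      moreover have "?T \<noteq> {}"
      proof
        assume "?T = {}"
        then have "K \<le> bot" by (intro isLub_le[OF K]) blast
        then show False using KG GG building_set_bot[OF b] by (simp add: bot_unique)
      qed
      ultimately obtain t where t: "?T = {t}" using singleton_if_not_card_ge_2[of ?T] by blast
      then have "K \<le> t" by (intro isLub_le[OF K]) auto
      moreover have "t \<in> T" "t \<le> G" using t by auto
      ultimately show ?thesis using KG by simp
    qed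
    moreover have "t \<in> factors \<G> J" if "t \<in> T" for t
    proof -
      have "t \<in> \<G>" "t \<le> J" using isLub_upper[OF J(1) that] that TG by auto
      then obtain H where "H \<in> factors \<G> J" "t \<le> H" by (rule le_factorE)
      then show ?thesis using fT anti that by metis
    qed
    ultimately show ?thesis unfolding T_def by blast
  qed
qed

section \<open>Splitting the weights on a chain over factors\<close>

text \<open>Unnormalised: every factor of \<open>X\<close> receives the full weight
  \<open>y X\<close>. The division by the number of factors is made only in the final map
  \<open>\<Psi>\<close>.\<close>

definition split_weights :: "'a::order set \<Rightarrow> ('a \<Rightarrow> real) \<Rightarrow> 'a \<Rightarrow> real" where
  "split_weights \<G> y G = (\<Sum>X | G \<in> factors \<G> X. y X)"

text \<open>The total weight is left free, so that the class is closed under the removal of weight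
  on which the inductions rest.\<close>

definition is_chain_weight :: "('a::order_bot \<Rightarrow> real) \<Rightarrow> bool" where
  "is_chain_weight y \<longleftrightarrow> (\<forall>X. 0 \<le> y X) \<and> y bot = 0 \<and> Complete_Partial_Order.chain (\<le>) {X. y X \<noteq> 0}"

lemma is_chain_weightI:
  assumes "\<And>X. 0 \<le> y X" "y bot = 0" "Complete_Partial_Order.chain (\<le>) {X. y X \<noteq> 0}"
  shows "is_chain_weight y"
  using assms by (simp add: is_chain_weight_def)

lemma split_weights_nonneg: "(\<And>X. 0 \<le> y X) \<Longrightarrow> 0 \<le> split_weights \<G> y G"
  by (simp add: split_weights_def sum_nonneg)

text \<open>Nonnegative summands cannot cancel.\<close>

lemma support_split_weights:
  fixes y :: "'a::{finite, order} \<Rightarrow> real"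
  assumes "\<And>X. 0 \<le> y X"
  shows "{G. split_weights \<G> y G \<noteq> 0} = (\<Union>X\<in>{X. y X \<noteq> 0}. factors \<G> X)"
  using assms by (auto simp: split_weights_def sum_nonneg_eq_0_iff)

lemma split_weights_add_single:
  fixes y :: "'a::{finite, order} \<Rightarrow> real"
  shows "split_weights \<G> (y(J := y J + m)) G
    = split_weights \<G> y G + (if G \<in> factors \<G> J then m else 0)"
proof -
  have "split_weights \<G> (y(J := y J + m)) G
      = (\<Sum>X | G \<in> factors \<G> X. y X + (if X = J then m else 0))"
    unfolding split_weights_def by (intro sum.cong) auto
  then show ?thesis by (simp add: split_weights_def sum.distrib)
qed

text \<open>For an antichain \<open>T\<close> of factors, the largest \<open>Z\<close> in the chain
  with a factor in \<open>T\<close> bounds \<open>T\<close>, so the join \<open>J\<close> exists and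
  \<open>J \<le> Z\<close>. If \<open>J\<close> were in \<open>\<G>\<close>, maximality of a factor
  \<open>t \<in> T\<close> of \<open>Z\<close> would give \<open>J = t\<close>. All of
  \<open>T\<close> would then lie below \<open>t\<close>, leaving only one element.\<close>

lemma nested_factors_chain:
  fixes C :: "'a::{finite, semilattice_inf, order_bot} set"
  assumes C: "Complete_Partial_Order.chain (\<le>) C"
  shows "nested \<G> (\<Union>X\<in>C. factors \<G> X)"
  unfolding nested_def
proof (intro conjI allI impI)
  show "(\<Union>X\<in>C. factors \<G> X) \<subseteq> \<G>" using factors_subset by blast
  fix T
  assume "T \<subseteq> (\<Union>X\<in>C. factors \<G> X) \<and> finite T \<and> 2 \<le> card T \<and>
    (\<forall>X\<in>T. \<forall>Y\<in>T. X \<noteq> Y \<longrightarrow> \<not> X \<le> Y)"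
  then have T: "T \<subseteq> (\<Union>X\<in>C. factors \<G> X)" "2 \<le> card T"
    and anti: "\<And>X Y. X \<in> T \<Longrightarrow> Y \<in> T \<Longrightarrow> X \<le> Y \<Longrightarrow> X = Y" by blast+
  let ?D = "{X \<in> C. factors \<G> X \<inter> T \<noteq> {}}"
  have "T \<noteq> {}" using T(2) by auto
  then have "?D \<noteq> {}" using T(1) by blast
  then obtain Z where Z: "Z \<in> ?D" "\<And>X. X \<in> ?D \<Longrightarrow> Z \<le> X \<Longrightarrow> Z = X"
    using finite_has_maximal[of ?D] by auto
  have D: "X \<le> Z" if "X \<in> ?D" for X
    using Z that C unfolding Complete_Partial_Order.chain_def by (metis (no_types, lifting) mem_Collect_eq)
  have TZ: "t \<le> Z" if t: "t \<in> T" for t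
  proof -
    obtain X where "X \<in> C" "t \<in> factors \<G> X" using T(1) t by blast
    then show ?thesis using D[of X] factors_le[of t \<G> X] t by (auto intro: order_trans)
  qed
  obtain J where J: "isLub UNIV T J" using isLub_bounded_exists[OF TZ] by blast
  have "J \<notin> \<G>"
  proof
    assume "J \<in> \<G>"
    obtain t where t: "t \<in> factors \<G> Z" "t \<in> T" using Z(1) by blast
    have "J = t"
      using factors_maximal[OF t(1) \<open>J \<in> \<G>\<close> isLub_le[OF J TZ] isLub_upper[OF J t(2)]] .
    then have "s = t" if "s \<in> T" for s using isLub_upper[OF J] anti that t(2) by blast
    then have "T \<subseteq> {t}" by blast
    then have "card T \<le> 1" using card_mono[of "{t}" T] by simp
    then show False using T(2) by simp
  qed
  then show "\<exists>J. isLub UNIV T J \<and> J \<notin> \<G>" using J by blast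
qed

lemma is_chain_weight_subtract:
  assumes "is_chain_weight y" "0 \<le> m" "m \<le> y J"
  shows "is_chain_weight (y(J := y J - m))"
proof (rule is_chain_weightI)
  show "0 \<le> (y(J := y J - m)) X" for X using assms by (simp add: is_chain_weight_def)
  show "(y(J := y J - m)) bot = 0" using assms by (auto simp: is_chain_weight_def)
  show "Complete_Partial_Order.chain (\<le>) {X. (y(J := y J - m)) X \<noteq> 0}"
    by (rule chain_subset[of _ "{X. y X \<noteq> 0}"]) (use assms in \<open>auto simp: is_chain_weight_def\<close>)
qed

lemma is_chain_weight_top:
  fixes y :: "'a::{finite, order_bot} \<Rightarrow> real"
  assumes "is_chain_weight y" "y X \<noteq> 0"
  obtains J where "y J \<noteq> 0" "\<And>Z. y Z \<noteq> 0 \<Longrightarrow> Z \<le> J"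
proof -
  obtain J where J: "J \<in> {X. y X \<noteq> 0}" "\<And>Z. Z \<in> {X. y X \<noteq> 0} \<Longrightarrow> J \<le> Z \<Longrightarrow> J = Z"
    using finite_has_maximal[of "{X. y X \<noteq> 0}"] assms(2) by auto
  have "Z \<le> J" if "y Z \<noteq> 0" for Z
    using J that assms(1) unfolding is_chain_weight_def Complete_Partial_Order.chain_def by force
  then show ?thesis using that J by blast
qed

text \<open>Equal images have equal supports, so each factor of \<open>X\<close> is a factor of some
  \<open>Z\<close> in the support of \<open>z\<close>, hence lies below \<open>J\<close>. Applied in
  both directions, this identifies the largest support elements of two weights with the same
  image.\<close>

lemma split_weights_eq_le_top:
  fixes y z :: "'a::{finite, semilattice_inf, order_bot} \<Rightarrow> real"
  assumes b: "building_set \<G>" and y: "is_chain_weight y" and z: "is_chain_weight z"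
    and eq: "split_weights \<G> y = split_weights \<G> z"
    and X: "y X \<noteq> 0" and J: "\<And>Z. z Z \<noteq> 0 \<Longrightarrow> Z \<le> J"
  shows "X \<le> J"
proof (rule le_if_factors_le[OF b])
  fix G assume "G \<in> factors \<G> X"
  then have "G \<in> (\<Union>X\<in>{X. y X \<noteq> 0}. factors \<G> X)" using X by blast
  also have "\<dots> = (\<Union>X\<in>{X. z X \<noteq> 0}. factors \<G> X)"
    using support_split_weights[of y \<G>] support_split_weights[of z \<G>] y z eq
    by (simp add: is_chain_weight_def)
  finally obtain Z where "z Z \<noteq> 0" "G \<in> factors \<G> Z" by blast
  then show "G \<le> J" using J factors_le order_trans by metis
qed

text \<open>
  Both weights have the same largest support element \<open>J\<close>, the join of the support of the
  common image; the smaller of the two weights at \<open>J\<close> is subtracted from both.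
\<close>

lemma split_weights_inj:
  fixes y z :: "'a::{finite, semilattice_inf, order_bot} \<Rightarrow> real"
  assumes b: "building_set \<G>" and "is_chain_weight y" "is_chain_weight z"
    and "split_weights \<G> y = split_weights \<G> z"
  shows "y = z"
  using assms(2-)
proof (induction "card {X. y X \<noteq> 0} + card {X. z X \<noteq> 0}" arbitrary: y z rule: less_induct)
  case less
  note y = less.prems(1) and z = less.prems(2) and eq = less.prems(3)
  have supp: "(\<Union>X\<in>{X. y X \<noteq> 0}. factors \<G> X) = (\<Union>X\<in>{X. z X \<noteq> 0}. factors \<G> X)"
    using support_split_weights[of y \<G>] support_split_weights[of z \<G>] y z eq
    by (simp add: is_chain_weight_def)
  \<comment> \<open>Elements other than \<open>bot\<close> have at least one factor, so a chain
    weight is zero exactly when its image has empty support.\<close>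
  have zero: "y = (\<lambda>_. 0) \<longleftrightarrow> z = (\<lambda>_. 0)"
  proof -
    have "w = (\<lambda>_. 0) \<longleftrightarrow> (\<Union>X\<in>{X. w X \<noteq> 0}. factors \<G> X) = {}" if "is_chain_weight w" for w
    proof -
      have "X \<noteq> bot" if "w X \<noteq> 0" for X
        using that \<open>is_chain_weight w\<close> unfolding is_chain_weight_def by metis
      then show ?thesis using factors_nonempty[OF b] by auto
    qed
    then show ?thesis using y z supp by (simp only:)
  qed
  show ?case
  proof (cases "y = (\<lambda>_. 0)")
    case True
    then show ?thesis using zero by simp
  next
    case False
    then obtain X X' where "y X \<noteq> 0" "z X' \<noteq> 0" using zero by (metis ext)
    then obtain J J' where J: "y J \<noteq> 0" "\<And>Z. y Z \<noteq> 0 \<Longrightarrow> Z \<le> J"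
      and J': "z J' \<noteq> 0" "\<And>Z. z Z \<noteq> 0 \<Longrightarrow> Z \<le> J'"
      using is_chain_weight_top[OF y] is_chain_weight_top[OF z] by metis
    have "J = J'"
      using split_weights_eq_le_top[OF b y z eq J(1) J'(2)]
        split_weights_eq_le_top[OF b z y eq[symmetric] J'(1) J(2)] by simp
    define m where "m = min (y J) (z J)"
    have m: "0 \<le> m" "m \<le> y J" "m \<le> z J" "m \<noteq> 0" "m = y J \<or> m = z J"
      using y z J(1) J'(1) \<open>J = J'\<close> by (auto simp: m_def is_chain_weight_def min_def)
    let ?y = "y(J := y J - m)" and ?z = "z(J := z J - m)"
    have le: "{X. ?y X \<noteq> 0} \<subseteq> {X. y X \<noteq> 0}" "{X. ?z X \<noteq> 0} \<subseteq> {X. z X \<noteq> 0}"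
      using J(1) J'(1) \<open>J = J'\<close> by auto
    \<comment> \<open>Since \<open>m\<close> is one of the two weights at \<open>J\<close>, the
      element \<open>J\<close> leaves at least one support, and the induction measure drops.\<close>
    have "{X. ?y X \<noteq> 0} \<subset> {X. y X \<noteq> 0} \<or> {X. ?z X \<noteq> 0} \<subset> {X. z X \<noteq> 0}"
      using m(5) J(1) J'(1) \<open>J = J'\<close> le by (metis (mono_tags, lifting) diff_self fun_upd_same mem_Collect_eq psubsetI)
    then have "card {X. ?y X \<noteq> 0} + card {X. ?z X \<noteq> 0} < card {X. y X \<noteq> 0} + card {X. z X \<noteq> 0}"
      using psubset_card_mono[of "{X. y X \<noteq> 0}"] psubset_card_mono[of "{X. z X \<noteq> 0}"]
        card_mono[OF _ le(1)] card_mono[OF _ le(2)] by (meson add_less_le_mono add_le_less_mono finite)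
    moreover have "split_weights \<G> ?y = split_weights \<G> ?z"
      using split_weights_add_single[of \<G> y J "-m"] split_weights_add_single[of \<G> z J "-m"] eq
      by (simp add: fun_eq_iff)
    ultimately have "?y = ?z"
      using less.hyps is_chain_weight_subtract[OF y m(1,2)] is_chain_weight_subtract[OF z m(1,3)]
      by blast
    show ?thesis
    proof
      fix X
      show "y X = z X" using fun_cong[OF \<open>?y = ?z\<close>, of X] by (cases "X = J") auto
    qed
  qed
qed

text \<open>Induction on the size of the support: removing the minimum \<open>m\<close> from all
  maximal elements kills at least \<open>G0\<close>, and the remaining support is nested as a subset
  of a nested set.\<close>

lemma split_weights_surj:
  fixes x :: "'a::{finite, semilattice_inf, order_bot} \<Rightarrow> real"
  assumes b: "building_set \<G>" and "\<And>G. 0 \<le> x G" "nested \<G> {G. x G \<noteq> 0}"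
  shows "\<exists>y. is_chain_weight y \<and> split_weights \<G> y = x"
  using assms(2-)
proof (induction "card {G. x G \<noteq> 0}" arbitrary: x rule: less_induct)
  case less
  let ?S = "{G. x G \<noteq> 0}" and ?T = "maximal_elements {G. x G \<noteq> 0}"
  show ?case
  proof (cases "?S = {}")
    case True
    then have "is_chain_weight (\<lambda>_::'a. 0) \<and> split_weights \<G> (\<lambda>_. 0) = x"
      by (auto simp: is_chain_weight_def split_weights_def Complete_Partial_Order.chain_def fun_eq_iff)
    then show ?thesis by blast
  next
    case False
    then obtain J where J: "factors \<G> J = ?T" using factors_nested_join[OF b less.prems(2)] by blast
    have T: "?T \<subseteq> ?S" by (auto simp: maximal_elements_def)
    have "?T \<noteq> {}" using False maximal_elementsE by (metis empty_iff ex_in_conv)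
    have "J \<noteq> bot" using J \<open>?T \<noteq> {}\<close> factors_bot[OF b] by metis
    define m where "m = Min (x ` ?T)"
    have "m \<in> x ` ?T" unfolding m_def by (rule Min_in) (use \<open>?T \<noteq> {}\<close> in simp_all)
    then obtain G0 where G0: "G0 \<in> ?T" "m = x G0" by blast
    have m_le: "m \<le> x G" if "G \<in> ?T" for G using that by (simp add: m_def)
    have "0 < m" using G0 T less.prems(1)[of G0] by auto
    define x' where "x' G = x G - (if G \<in> ?T then m else 0)" for G
    have x'0: "0 \<le> x' G" for G using m_le less.prems(1) by (auto simp: x'_def)
    have sub: "{G. x' G \<noteq> 0} \<subseteq> ?S" using T by (auto simp: x'_def split: if_splits)
    moreover have "G0 \<notin> {G. x' G \<noteq> 0}" "G0 \<in> ?S" using G0 T by (auto simp: x'_def)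
    ultimately have "card {G. x' G \<noteq> 0} < card ?S" by (intro psubset_card_mono) auto
    then obtain y' where y': "is_chain_weight y'" "split_weights \<G> y' = x'"
      using less.hyps x'0 nested_subset[OF less.prems(2) sub] by blast
    \<comment> \<open>This keeps the support a chain when \<open>J\<close> is added: factors of
      \<open>X\<close> lie in the support of \<open>x'\<close>, hence below maximal elements of
      \<open>?S\<close>, which are the factors of \<open>J\<close>.\<close>
    have le_J: "X \<le> J" if "y' X \<noteq> 0" for X
    proof (rule le_if_factors_le[OF b])
      fix G assume "G \<in> factors \<G> X"
      then have "G \<in> {G. split_weights \<G> y' G \<noteq> 0}"
        using that y'(1) by (subst support_split_weights) (auto simp: is_chain_weight_def)
      then have "G \<in> ?S" using y'(2) sub by blast
      then obtain H where "H \<in> ?T" "G \<le> H" using maximal_elementsE by metis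
      then show "G \<le> J" using J factors_le order_trans by metis
    qed
    let ?y = "y'(J := y' J + m)"
    have "is_chain_weight ?y"
    proof (rule is_chain_weightI)
      show "0 \<le> ?y X" for X using y'(1) \<open>0 < m\<close> by (simp add: is_chain_weight_def)
      show "?y bot = 0" using y'(1) \<open>J \<noteq> bot\<close> by (simp add: is_chain_weight_def)
      have "Complete_Partial_Order.chain (\<le>) (insert J {X. y' X \<noteq> 0})"
        using y'(1) le_J by (auto simp: is_chain_weight_def Complete_Partial_Order.chain_def)
      then show "Complete_Partial_Order.chain (\<le>) {X. ?y X \<noteq> 0}"
        by (rule chain_subset) (auto split: if_splits)
    qed
    moreover have "split_weights \<G> ?y = x"
      using split_weights_add_single[of \<G> y' J m] y'(2) J by (auto simp: fun_eq_iff x'_def)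
    ultimately show ?thesis by blast
  qed
qed

text \<open>Double counting of the pairs of an element and one of its factors; it determines the
  rescaling that preserves total weight.\<close>

lemma sum_split_weights:
  fixes y :: "'a::{finite, order} \<Rightarrow> real"
  shows "(\<Sum>G\<in>UNIV. split_weights \<G> y G) = (\<Sum>X\<in>UNIV. real (card (factors \<G> X)) * y X)"
proof -
  have "(\<Sum>G\<in>UNIV. split_weights \<G> y G) = (\<Sum>G\<in>UNIV. \<Sum>X\<in>UNIV. if G \<in> factors \<G> X then y X else 0)"
    unfolding split_weights_def by (simp add: sum.If_cases)
  also have "\<dots> = (\<Sum>X\<in>UNIV. \<Sum>G\<in>UNIV. if G \<in> factors \<G> X then y X else 0)"
    by (rule sum.swap)
  finally show ?thesis by (simp add: sum.If_cases)
qed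

section \<open>Realizations as compact subsets of a function space, and the homeomorphism\<close>

definition realization_points :: "'v set set \<Rightarrow> ('v \<Rightarrow> real) set" where
  "realization_points K = {x. (\<forall>v. 0 \<le> x v) \<and> {v. x v \<noteq> 0} \<in> K \<and> (\<Sum>v | x v \<noteq> 0. x v) = 1}"

text \<open>The type class topology on functions is the product topology, so \<open>compact\<close>
  and \<open>homeomorphic\<close> become applicable to the realization.\<close>

lemma geometric_realization_eq: "geometric_realization K = top_of_set (realization_points K)"
  by (simp add: geometric_realization_def realization_points_def euclidean_product_topology)

lemma realization_points_finite:
  fixes K :: "'v::finite set set"
  shows "realization_points K = {x. (\<forall>v. 0 \<le> x v) \<and> {v. x v \<noteq> 0} \<in> K \<and> (\<Sum>v\<in>UNIV. x v) = 1}"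
proof -
  have "(\<Sum>v | x v \<noteq> 0. x v) = (\<Sum>v\<in>UNIV. x v)" for x :: "'v \<Rightarrow> real"
    by (rule sum.mono_neutral_left) auto
  then show ?thesis by (simp add: realization_points_def)
qed

lemma homeomorphic_imp_homeomorphic_space:
  assumes "S homeomorphic T"
  shows "top_of_set S homeomorphic_space top_of_set T"
proof -
  obtain f g where "homeomorphism S T f g"
    using assms by (auto simp: homeomorphic_def)
  then have "homeomorphic_maps (top_of_set S) (top_of_set T) f g"
    by (auto simp: homeomorphism_def homeomorphic_maps_def)
  then show ?thesis
    unfolding homeomorphic_space_def by blast
qed

text \<open>Because \<open>K\<close> is closed under subsets, having support in \<open>K\<close>
  means vanishing outside some \<sigma> in \<open>K\<close>. This is a finite union of closed
  conditions, so the realization is a closed part of the cube.\<close>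

lemma compact_realization_points:
  fixes K :: "'v::finite set set"
  assumes "\<And>\<sigma> \<tau>. \<sigma> \<in> K \<Longrightarrow> \<tau> \<subseteq> \<sigma> \<Longrightarrow> \<tau> \<in> K"
  shows "compact (realization_points K)"
proof -
  define C where "C = (\<Union>\<sigma>\<in>K. \<Inter>v\<in>-\<sigma>. {x::'v \<Rightarrow> real. x v = 0}) \<inter> {x. (\<Sum>v\<in>UNIV. x v) = 1}"
  have cont: "continuous_on UNIV (\<lambda>x::'v \<Rightarrow> real. x v)" for v
    by (rule continuous_on_product_coordinates)
  have "closed C" unfolding C_def
    by (intro closed_Int closed_UN finite ballI closed_INT closed_Collect_eq continuous_on_sum
        cont continuous_on_const)
  moreover have "compact (\<Pi>\<^sub>E v\<in>(UNIV::'v set). {0..1::real})"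
    using compactin_PiE[of "\<lambda>_::'v. euclidean :: real topology" UNIV "\<lambda>_. {0..1}"]
    by (simp add: euclidean_product_topology)
  ultimately have "compact ((\<Pi>\<^sub>E v\<in>(UNIV::'v set). {0..1::real}) \<inter> C)" by blast
  moreover have "(\<Pi>\<^sub>E v\<in>(UNIV::'v set). {0..1::real}) \<inter> C = realization_points K"
  proof (rule set_eqI)
    fix x :: "'v \<Rightarrow> real"
    have "x v \<le> 1" if "\<forall>v. 0 \<le> x v" "(\<Sum>v\<in>UNIV. x v) = 1" for v
      using member_le_sum[of v UNIV x] that by simp
    moreover have "(\<exists>\<sigma>\<in>K. \<forall>v\<in>-\<sigma>. x v = 0) \<longleftrightarrow> {v. x v \<noteq> 0} \<in> K"
    proof
      assume "\<exists>\<sigma>\<in>K. \<forall>v\<in>-\<sigma>. x v = 0"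
      then obtain \<sigma> where "\<sigma> \<in> K" "{v. x v \<noteq> 0} \<subseteq> \<sigma>" by blast
      then show "{v. x v \<noteq> 0} \<in> K" using assms by blast
    qed auto
    ultimately show "x \<in> (\<Pi>\<^sub>E v\<in>UNIV. {0..1}) \<inter> C \<longleftrightarrow> x \<in> realization_points K"
      unfolding realization_points_finite C_def by (auto simp: PiE_iff)
  qed
  ultimately show ?thesis by simp
qed

theorem corollary4p3:
  fixes \<G> :: "'a::{finite, semilattice_inf, order_bot} set"
  assumes "atomic TYPE('a)"
    and "building_set \<G>"
  shows "homeomorphic_complexes (nested_set_complex \<G>) (order_complex (UNIV - {bot :: 'a}))"
proof -
  note b = assms(2)
  let ?N = "nested_set_complex \<G>" and ?D = "order_complex (UNIV - {bot :: 'a})"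
  define c where "c X = real (card (factors \<G> X))" for X
  \<comment> \<open>Dividing by the number of factors makes the images have total weight 1, by
    \<open>sum_split_weights\<close>.\<close>
  define \<Psi> where "\<Psi> y = split_weights \<G> (\<lambda>X. y X / c X)" for y
  have c: "0 < c X" if "X \<noteq> bot" for X
    using factors_nonempty[OF b that] by (simp add: c_def card_gt_0_iff)
  have D: "is_chain_weight (\<lambda>X. y X / c X) \<and> (\<Sum>X\<in>UNIV. c X * (y X / c X)) = 1"
    if "y \<in> realization_points ?D" for y
  proof
    have y: "\<And>X. 0 \<le> y X" "y bot = 0" "Complete_Partial_Order.chain (\<le>) {X. y X \<noteq> 0}"
      "(\<Sum>X\<in>UNIV. y X) = 1"
      using that by (auto simp: realization_points_finite order_complex_def)
    show "is_chain_weight (\<lambda>X. y X / c X)"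
    proof (rule is_chain_weightI)
      show "Complete_Partial_Order.chain (\<le>) {X. y X / c X \<noteq> 0}"
        by (rule chain_subset[OF y(3)]) auto
    qed (use y(1,2) in \<open>auto simp: c_def\<close>)
    have "c X * (y X / c X) = y X" for X using c[of X] y(2) by (cases "X = bot") auto
    then show "(\<Sum>X\<in>UNIV. c X * (y X / c X)) = 1" using y(4) by simp
  qed
  have "\<Psi> ` realization_points ?D = realization_points ?N"
  proof (intro equalityI subsetI)
    fix x assume "x \<in> \<Psi> ` realization_points ?D"
    then obtain y where y: "y \<in> realization_points ?D" "x = \<Psi> y" by blast
    let ?w = "\<lambda>X. y X / c X"
    have w: "\<And>X. 0 \<le> ?w X" "Complete_Partial_Order.chain (\<le>) {X. ?w X \<noteq> 0}"
      using D[OF y(1)] by (auto simp: is_chain_weight_def)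
    have "nested \<G> {G. x G \<noteq> 0}"
      unfolding y(2) \<Psi>_def support_split_weights[OF w(1)] by (rule nested_factors_chain[OF w(2)])
    moreover have "(\<Sum>G\<in>UNIV. x G) = 1"
      using D[OF y(1)] sum_split_weights[of \<G> ?w] by (simp add: y(2) \<Psi>_def c_def)
    ultimately show "x \<in> realization_points ?N"
      using split_weights_nonneg[where y = ?w, OF w(1)]
      by (simp add: realization_points_finite nested_set_complex_def y(2) \<Psi>_def)
  next
    fix x assume "x \<in> realization_points ?N"
    then have x: "\<And>G. 0 \<le> x G" "nested \<G> {G. x G \<noteq> 0}" "(\<Sum>G\<in>UNIV. x G) = 1"
      by (auto simp: realization_points_finite nested_set_complex_def)
    obtain w where w: "is_chain_weight w" "split_weights \<G> w = x"
      using split_weights_surj[OF b x(1,2)] by blast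
    \<comment> \<open>This undoes the division by \<open>c\<close>. At \<open>bot\<close>, where
      \<open>c\<close> is zero, \<open>w\<close> vanishes as well.\<close>
    let ?y = "\<lambda>X. c X * w X"
    have "?y X / c X = w X" for X
      using c[of X] w(1) by (cases "X = bot") (auto simp: is_chain_weight_def)
    then have "\<Psi> ?y = x" using w(2) by (simp add: \<Psi>_def)
    moreover have "?y \<in> realization_points ?D"
    proof -
      have "Complete_Partial_Order.chain (\<le>) {X. ?y X \<noteq> 0}"
        by (rule chain_subset[of _ "{X. w X \<noteq> 0}"]) (use w(1) in \<open>auto simp: is_chain_weight_def\<close>)
      moreover have "(\<Sum>X\<in>UNIV. ?y X) = 1"
        using sum_split_weights[of \<G> w] w(2) x(3) by (simp add: c_def)
      ultimately show ?thesis
        using w(1) by (auto simp: realization_points_finite order_complex_def is_chain_weight_def c_def)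
    qed
    ultimately show "x \<in> \<Psi> ` realization_points ?D" by blast
  qed
  moreover have "inj_on \<Psi> (realization_points ?D)"
  proof (rule inj_onI)
    fix y z assume yz: "y \<in> realization_points ?D" "z \<in> realization_points ?D" "\<Psi> y = \<Psi> z"
    then have "(\<lambda>X. y X / c X) = (\<lambda>X. z X / c X)"
      using split_weights_inj[OF b] D unfolding \<Psi>_def by blast
    \<comment> \<open>The factor \<open>c X\<close> can be cancelled only for
      \<open>X \<noteq> bot\<close>, so equality at \<open>bot\<close> is obtained
      separately.\<close>
    moreover have "y bot = 0" "z bot = 0"
      using yz by (auto simp: realization_points_finite order_complex_def)
    ultimately show "y = z" using c by (metis (no_types, lifting) ext divide_cancel_right less_irrefl)
  qed
  moreover have "continuous_on (realization_points ?D) \<Psi>"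
  proof (rule continuous_on_coordinatewise_then_product)
    fix G
    show "continuous_on (realization_points ?D) (\<lambda>y. \<Psi> y G)"
      unfolding \<Psi>_def split_weights_def divide_inverse
      by (intro continuous_on_sum continuous_on_mult_right
          continuous_on_subset[OF continuous_on_product_coordinates]) auto
  qed
  moreover have "compact (realization_points ?D)"
    by (rule compact_realization_points)
      (auto simp: order_complex_def intro: chain_subset)
  ultimately have "realization_points ?D homeomorphic realization_points ?N"
    by (metis homeomorphic_compact)
  then have "top_of_set (realization_points ?D) homeomorphic_space top_of_set (realization_points ?N)"
    by (rule homeomorphic_imp_homeomorphic_space)
  then show ?thesis
    unfolding homeomorphic_complexes_def geometric_realization_eq
    by (rule homeomorphic_space_sym[THEN iffD1])
qed

end
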